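(* Let $G$ be a planar bipartite graph with maximum degree $\Delta$, and let $H$ be a subgraph of $G$ with maximum degree at most $d$. Then any total-$(\Delta+d+4)$-coloring of $H$ in $G$ can be extended to a total-$(\Delta+d+4)$-coloring of $G$.
   Context: All graphs are simple. A total-$k$-coloring of a graph is an assignment of colors from $\{1,\dots,k\}$ to its vertices and edges such that adjacent vertices receive different colors, edges sharing an endpoint receive different colors, and no edge receives the same color as either of its endpoints. For a subgraph $H$ of $G$, a total-$k$-coloring $\varphi$ of $H$ is a total-$k$-coloring of $H$ in $G$ if, in addition, $\varphi(u)\neq\varphi(v)$ for all $u,v\in V(H)$ adjacent in $G$. Extending $\varphi$ to $G$ means finding a total-$k$-coloring of $G$ that agrees with $\varphi$ on all vertices and edges of $H$. *)

theory Defs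
  imports "HOL-Analysis.Analysis"
begin

definition simple_graph :: "'a set \<Rightarrow> 'a set set \<Rightarrow> bool" where
  "simple_graph V E \<longleftrightarrow> finite V \<and>
     (\<forall>e\<in>E. \<exists>u v. e = {u, v} \<and> u \<noteq> v \<and> u \<in> V \<and> v \<in> V)"

definition degree :: "'a set set \<Rightarrow> 'a \<Rightarrow> nat" where
  "degree E v = card {e\<in>E. v \<in> e}"

definition max_degree :: "'a set \<Rightarrow> 'a set set \<Rightarrow> nat" where
  "max_degree V E = Max (insert 0 (degree E ` V))"

definition subgraph :: "'a set \<Rightarrow> 'a set set \<Rightarrow> 'a set \<Rightarrow> 'a set set \<Rightarrow> bool" where
  "subgraph VH EH V E \<longleftrightarrow> VH \<subseteq> V \<and> EH \<subseteq> E \<and> (\<forall>e\<in>EH. e \<subseteq> VH)"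

definition bipartite :: "'a set \<Rightarrow> 'a set set \<Rightarrow> bool" where
  "bipartite V E \<longleftrightarrow> (\<exists>A B. A \<union> B = V \<and> A \<inter> B = {} \<and>
      (\<forall>e\<in>E. card (e \<inter> A) = 1 \<and> card (e \<inter> B) = 1))"

definition planar :: "'a set \<Rightarrow> 'a set set \<Rightarrow> bool" where
  "planar V E \<longleftrightarrow> (\<exists>(p :: 'a \<Rightarrow> complex) (\<gamma> :: 'a set \<Rightarrow> real \<Rightarrow> complex).
      inj_on p V \<and>
      (\<forall>e\<in>E. arc (\<gamma> e) \<and> {pathstart (\<gamma> e), pathfinish (\<gamma> e)} = p ` e \<and>
               path_image (\<gamma> e) \<inter> p ` V = p ` e) \<and>
      (\<forall>e\<in>E. \<forall>e'\<in>E. e \<noteq> e' \<longrightarrow> path_image (\<gamma> e) \<inter> path_image (\<gamma> e') = p ` (e \<inter> e')))"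

definition total_coloring_in ::
  "'a set \<Rightarrow> 'a set set \<Rightarrow> 'a set \<Rightarrow> 'a set set \<Rightarrow> nat \<Rightarrow> ('a \<Rightarrow> nat) \<Rightarrow> ('a set \<Rightarrow> nat) \<Rightarrow> bool" where
  "total_coloring_in V E VH EH k vc ec \<longleftrightarrow>
     (\<forall>v\<in>VH. vc v \<in> {1..k}) \<and> (\<forall>e\<in>EH. ec e \<in> {1..k}) \<and>
     (\<forall>u\<in>VH. \<forall>v\<in>VH. {u, v} \<in> E \<longrightarrow> vc u \<noteq> vc v) \<and>
     (\<forall>e\<in>EH. \<forall>e'\<in>EH. e \<noteq> e' \<and> e \<inter> e' \<noteq> {} \<longrightarrow> ec e \<noteq> ec e') \<and>
     (\<forall>e\<in>EH. \<forall>v\<in>e. ec e \<noteq> vc v)"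

end

theory Submission
  imports Defs
begin

text \<open>
  Colour the remaining vertices greedily. What is left is a list edge colouring problem on the
  bipartite graph G - E(H): the edge uv has at least Delta + d + 2 - d_H(u) - d_H(v) admissible
  colours, which is at least the larger of its end degrees in G - E(H). The theorem of Borodin,
  Kostochka and Woodall, that a bipartite multigraph is edge colourable from lists with
  |L(uv)| >= max(d(u), d(v)), then applies.

  For that theorem, rank the edges at every vertex so that each edge uv has fewer than
  max(d(u), d(v)) better ranked edges at its two ends together. Galvin's argument colours such a
  multigraph by repeatedly giving one colour to a stable matching of the edges that admit it. The
  ranking is built by removing a matching M such that every edge xy with x covered by M has
  y covered too or d(y) < d(x): the edges of M are put first on the x side and last on the y side.
\<close>

section \<open>Hall's theorem\<close>

text \<open>Induction on \<open>card X\<close>. A proper nonempty \<open>S\<close> with exactly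
  \<open>card S\<close> neighbours is matched on its own and its neighbours are withdrawn from the
  rest. If there is no such \<open>S\<close>, every proper nonempty subset has a neighbour to spare,
  and any single pair \<open>x\<close>, \<open>y\<close> may be matched first.\<close>

lemma Hall:
  fixes N :: "'a \<Rightarrow> 'b set"
  assumes "finite X" "\<And>x. x \<in> X \<Longrightarrow> finite (N x)"
    and "\<And>S. S \<subseteq> X \<Longrightarrow> card S \<le> card (\<Union>(N ` S))"
  shows "\<exists>m. inj_on m X \<and> (\<forall>x\<in>X. m x \<in> N x)"
  using assms
proof (induction "card X" arbitrary: X N rule: less_induct)
  case less
  note fin = less.prems(1) and finN = less.prems(2) and hall = less.prems(3)
  show ?case
  proof (cases "X = {}")
    case False
    then obtain x where x: "x \<in> X" by blast
    show ?thesis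
    proof (cases "\<exists>S. S \<subseteq> X \<and> S \<noteq> {} \<and> S \<noteq> X \<and> card (\<Union>(N ` S)) = card S")
      case True
      then obtain S where S: "S \<subseteq> X" "S \<noteq> {}" "S \<noteq> X" "card (\<Union>(N ` S)) = card S"
        by blast
      have finS: "finite S" using S fin finite_subset by blast
      have "card S < card X" using S fin by (simp add: psubset_card_mono psubset_eq)
      then have "\<exists>m. inj_on m S \<and> (\<forall>x\<in>S. m x \<in> N x)"
        using less.hyps[of S N] finS finN hall S(1) by (meson subsetD subset_trans)
      then obtain m1 where m1: "inj_on m1 S" "\<forall>x\<in>S. m1 x \<in> N x" by blast
      define U where "U = \<Union>(N ` S)"
      have "card (X - S) < card X"
        using S fin by (intro psubset_card_mono) auto
      \<comment> \<open>Hall's condition survives the removal of \<open>U\<close>: apply it to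
        \<open>T \<union> S\<close>, whose neighbourhood exceeds what \<open>T\<close> keeps by at
        most \<open>card U = card S\<close>.\<close>
      moreover have "card T \<le> card (\<Union>((\<lambda>x. N x - U) ` T))" if T: "T \<subseteq> X - S" for T
      proof -
        have finT: "finite T" using T fin finite_subset by blast
        have "card T + card S = card (T \<union> S)"
          using T finT finS by (subst card_Un_disjoint) auto
        also have "\<dots> \<le> card (\<Union>(N ` (T \<union> S)))" using T S by (intro hall) auto
        also have "\<Union>(N ` (T \<union> S)) = \<Union>((\<lambda>x. N x - U) ` T) \<union> U" unfolding U_def by auto
        also have "card \<dots> \<le> card (\<Union>((\<lambda>x. N x - U) ` T)) + card U" by (rule card_Un_le)
        finally show ?thesis using S(4) U_def by simp
      qed
      ultimately have "\<exists>m. inj_on m (X - S) \<and> (\<forall>x\<in>X - S. m x \<in> N x - U)"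
        using less.hyps[of "X - S" "\<lambda>x. N x - U"] fin finN by blast
      then obtain m2 where m2: "inj_on m2 (X - S)" "\<forall>x\<in>X - S. m2 x \<in> N x - U" by blast
      define m where "m = (\<lambda>x. if x \<in> S then m1 x else m2 x)"
      have m1U: "m1 x \<in> U" if "x \<in> S" for x using that m1 unfolding U_def by auto
      have "inj_on m X"
        using m1(1) m2 m1U unfolding m_def inj_on_def by (smt (verit) DiffD2 DiffI)
      moreover have "\<forall>x\<in>X. m x \<in> N x" using m1 m2 unfolding m_def by auto
      ultimately show ?thesis by blast
    next
      case False
      have "card {x} \<le> card (N x)" using hall[of "{x}"] x by simp
      then obtain y where y: "y \<in> N x" by fastforce
      have "card (X - {x}) < card X" using fin x by (rule card_Diff1_less)
      \<comment> \<open>\<open>T\<close> is a proper subset of \<open>X\<close> and therefore not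
        tight, so its surplus neighbour pays for the loss of \<open>y\<close>.\<close>
      moreover have "card T \<le> card (\<Union>((\<lambda>x. N x - {y}) ` T))" if T: "T \<subseteq> X - {x}" for T
      proof (cases "T = {}")
        case nonempty: False
        have finT: "finite T" using T fin finite_subset by blast
        have "card T \<le> card (\<Union>(N ` T))" "card (\<Union>(N ` T)) \<noteq> card T"
          using hall[of T] False T nonempty x by auto
        moreover have "card (\<Union>(N ` T)) \<le> card (\<Union>(N ` T) - {y}) + 1"
          using finT finN T by (subst card_Diff_singleton_if) auto
        ultimately have "card T \<le> card (\<Union>(N ` T) - {y})" by linarith
        also have "\<Union>(N ` T) - {y} = \<Union>((\<lambda>x. N x - {y}) ` T)" by auto
        finally show ?thesis .
      qed simp
      ultimately have "\<exists>m. inj_on m (X - {x}) \<and> (\<forall>z\<in>X - {x}. m z \<in> N z - {y})"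
        using less.hyps[of "X - {x}" "\<lambda>x. N x - {y}"] fin finN by blast
      then obtain m where m: "inj_on m (X - {x})" "\<forall>z\<in>X - {x}. m z \<in> N z - {y}" by blast
      have "inj_on (m(x := y)) X" using m unfolding inj_on_def by auto
      moreover have "\<forall>z\<in>X. (m(x := y)) z \<in> N z" using m y by auto
      ultimately show ?thesis by blast
    qed
  qed simp
qed

section \<open>Stable matchings and Galvin's argument\<close>

text \<open>A bipartite multigraph is given by a set of edges together with the maps \<open>p\<close> and \<open>q\<close> to
  the left and right ends. The ranks \<open>r\<close> and \<open>s\<close> of an edge among the edges with the same left
  and right end are best when small.\<close>

definition ranking :: "('e \<Rightarrow> 'a) \<Rightarrow> ('e \<Rightarrow> nat) \<Rightarrow> 'e set \<Rightarrow> bool" where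
  "ranking p r E \<longleftrightarrow> (\<forall>e\<in>E. \<forall>f\<in>E. p e = p f \<and> r e = r f \<longrightarrow> e = f)"

definition better :: "('e \<Rightarrow> 'a) \<Rightarrow> ('e \<Rightarrow> nat) \<Rightarrow> 'e set \<Rightarrow> 'e \<Rightarrow> 'e set" where
  "better p r E e = {f\<in>E. p f = p e \<and> r f < r e}"

lemma ranking_subset: "ranking p r E \<Longrightarrow> F \<subseteq> E \<Longrightarrow> ranking p r F"
  unfolding ranking_def by blast

lemma better_mono: "F \<subseteq> E \<Longrightarrow> better p r F e \<subseteq> better p r E e"
  unfolding better_def by blast

lemma finite_better: "finite E \<Longrightarrow> finite (better p r E e)"
  unfolding better_def by simp

text \<open>Let \<open>B\<close> consist of the best edge at each left vertex. If \<open>B\<close>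
  is a matching, it is stable. Otherwise two edges of \<open>B\<close> meet on the right, and the
  worse one, \<open>b\<close>, can be deleted: every stable matching of the remaining edges also
  dominates \<open>b\<close>.\<close>

lemma stable_matching_exists:
  assumes "finite F" "ranking p r F" "ranking q s F"
  shows "\<exists>M\<subseteq>F. inj_on p M \<and> inj_on q M \<and>
           (\<forall>e\<in>F - M. better p r M e \<union> better q s M e \<noteq> {})"
  using assms
proof (induction "card F" arbitrary: F rule: less_induct)
  case less
  define B where "B = {e\<in>F. \<forall>f\<in>F. p f = p e \<longrightarrow> r e \<le> r f}"
  have injp: "inj_on p B"
  proof (rule inj_onI)
    fix x y assume "x \<in> B" "y \<in> B" "p x = p y"
    then have "x \<in> F" "y \<in> F" "r x = r y" unfolding B_def by (auto intro: antisym)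
    then show "x = y" using \<open>p x = p y\<close> less.prems(2) unfolding ranking_def by blast
  qed
  have best: "\<exists>b\<in>B. p b = p e \<and> r b \<le> r e" if e: "e \<in> F" for e
  proof -
    have "e \<in> F \<and> p e = p e" using e by simp
    from ex_has_least_nat[of "\<lambda>f. f \<in> F \<and> p f = p e", OF this, of r]
    obtain b where "b \<in> F \<and> p b = p e" "\<forall>f. f \<in> F \<and> p f = p e \<longrightarrow> r b \<le> r f"
      by (elim exE conjE) simp
    then show ?thesis using e unfolding B_def by auto
  qed
  show ?case
  proof (cases "inj_on q B")
    case True
    have "better p r B e \<noteq> {}" if e: "e \<in> F - B" for e
    proof -
      obtain b where b: "b \<in> B" "p b = p e" "r b \<le> r e" using best[of e] e by blast
      then have "r b \<noteq> r e" using e less.prems(2) unfolding B_def ranking_def by fastforce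
      then show ?thesis using b unfolding better_def by auto
    qed
    then show ?thesis using True injp by (intro exI[of _ B]) (auto simp: B_def)
  next
    case False
    then obtain a b where ab': "a \<in> B" "b \<in> B" "q a = q b" "a \<noteq> b"
      unfolding inj_on_def by blast
    have "s a \<noteq> s b" using ab' less.prems(3) unfolding B_def ranking_def by blast
    with ab' obtain a b where ab: "a \<in> B" "b \<in> B" "q a = q b" "s a < s b"
      by (metis linorder_neqE_nat)
    then have abF: "a \<in> F - {b}" "b \<in> F" unfolding B_def by auto
    then have "card (F - {b}) < card F" using less.prems(1) by (intro card_Diff1_less)
    then obtain M where M: "M \<subseteq> F - {b}" "inj_on p M" "inj_on q M"
      "\<And>e. e \<in> F - {b} - M \<Longrightarrow> better p r M e \<union> better q s M e \<noteq> {}"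
      using less.hyps[of "F - {b}"] less.prems ranking_subset[of _ _ F "F - {b}"]
      by (metis Diff_subset finite_Diff)
    have "better q s M b \<noteq> {}"
    proof (cases "a \<in> M")
      case True
      then show ?thesis using ab unfolding better_def by auto
    next
      case False
      \<comment> \<open>As \<open>a\<close> is best at its left end, it must be dominated at its
        right end. The dominating edge is then better than \<open>b\<close> too, since
        \<open>b\<close> shares that end and \<open>s a < s b\<close>.\<close>
      have "better p r M a = {}" using ab(1) M(1) unfolding better_def B_def by fastforce
      then have "better q s M a \<noteq> {}" using M(4)[of a] abF False by blast
      then show ?thesis using ab unfolding better_def by fastforce
    qed
    then show ?thesis using M by (intro exI[of _ M]) blast
  qed
qed

text \<open>A colour \<open>a\<close> is given to a stable matching \<open>M\<close> of the edges
  whose lists contain \<open>a\<close>, then \<open>M\<close> and \<open>a\<close> are deleted. An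
  uncoloured edge that loses \<open>a\<close> from its list also loses a better edge, so the strict
  bound is preserved.\<close>

lemma list_edge_coloring_of_ranking:
  assumes "finite E" "ranking p r E" "ranking q s E"
    and "\<And>e. e \<in> E \<Longrightarrow> finite (L e)"
    and "\<And>e. e \<in> E \<Longrightarrow> card (better p r E e) + card (better q s E e) < card (L e)"
  shows "\<exists>c. (\<forall>e\<in>E. c e \<in> L e) \<and>
           (\<forall>e\<in>E. \<forall>f\<in>E. e \<noteq> f \<and> (p e = p f \<or> q e = q f) \<longrightarrow> c e \<noteq> c f)"
  using assms
proof (induction "card E" arbitrary: E L rule: less_induct)
  case less
  note fin = less.prems(1) and finL = less.prems(4) and bound = less.prems(5)
  show ?case
  proof (cases "E = {}")
    case False
    then obtain e0 where e0: "e0 \<in> E" by blast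
    then have "L e0 \<noteq> {}" using bound by fastforce
    then obtain a where a: "a \<in> L e0" by blast
    define F where "F = {e\<in>E. a \<in> L e}"
    have F: "F \<subseteq> E" "e0 \<in> F" "finite F" using fin e0 a unfolding F_def by auto
    then obtain M where M: "M \<subseteq> F" "inj_on p M" "inj_on q M"
      "\<And>e. e \<in> F - M \<Longrightarrow> better p r M e \<union> better q s M e \<noteq> {}"
      using stable_matching_exists[of F p r q s] less.prems(2,3) ranking_subset by metis
    \<comment> \<open>An empty \<open>M\<close> would leave \<open>e0\<close> undominated.
      Nonemptiness makes the induction on \<open>card E\<close> proceed.\<close>
    have "M \<noteq> {}" using M(4)[of e0] F(2) unfolding better_def by auto
    then have "card (E - M) < card E"
      using fin M(1) F(1) by (intro psubset_card_mono) auto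
    moreover have "card (better p r (E - M) e) + card (better q s (E - M) e) < card (L e - {a})"
      if e: "e \<in> E - M" for e
    proof -
      have fb: "finite (better p r E e)" "finite (better q s E e)"
        using finite_better[OF fin] by blast+
      have sub: "better p r (E - M) e \<subseteq> better p r E e" "better q s (E - M) e \<subseteq> better q s E e"
        by (simp_all add: better_mono)
      have le: "card (better p r (E - M) e) \<le> card (better p r E e)"
        "card (better q s (E - M) e) \<le> card (better q s E e)"
        using fb sub by (auto intro: card_mono)
      show ?thesis
      proof (cases "a \<in> L e")
        case True
        then have "better p r M e \<union> better q s M e \<noteq> {}" using M(4)[of e] e F_def by blast
        moreover have "better p r M e \<subseteq> better p r E e - better p r (E - M) e"
          "better q s M e \<subseteq> better q s E e - better q s (E - M) e"
          using M(1) F(1) unfolding better_def by auto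
        ultimately have "better p r (E - M) e \<subset> better p r E e \<or>
            better q s (E - M) e \<subset> better q s E e"
          using sub by blast
        then have "card (better p r (E - M) e) + card (better q s (E - M) e)
            < card (better p r E e) + card (better q s E e)"
          using psubset_card_mono[OF fb(1)] psubset_card_mono[OF fb(2)] le
          by (meson add_le_less_mono add_less_le_mono)
        moreover have "card (L e - {a}) = card (L e) - 1" using True by simp
        ultimately show ?thesis using bound[of e] e by simp
      next
        case False
        then show ?thesis using bound[of e] e le by simp
      qed
    qed
    moreover have "ranking p r (E - M)" "ranking q s (E - M)"
      using less.prems(2,3) ranking_subset by blast+
    ultimately have "\<exists>c. (\<forall>e\<in>E - M. c e \<in> L e - {a}) \<and>
        (\<forall>e\<in>E - M. \<forall>f\<in>E - M. e \<noteq> f \<and> (p e = p f \<or> q e = q f) \<longrightarrow> c e \<noteq> c f)"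
      using fin finL by (intro less.hyps) auto
    then obtain c where c: "\<forall>e\<in>E - M. c e \<in> L e - {a}"
      "\<forall>e\<in>E - M. \<forall>f\<in>E - M. e \<noteq> f \<and> (p e = p f \<or> q e = q f) \<longrightarrow> c e \<noteq> c f"
      by (elim exE conjE)
    define c' where "c' = (\<lambda>e. if e \<in> M then a else c e)"
    have "\<forall>e\<in>E. c' e \<in> L e" using c M(1) unfolding c'_def F_def by auto
    moreover have "c' e \<noteq> c' f"
      if "e \<in> E" "f \<in> E" "e \<noteq> f" "p e = p f \<or> q e = q f" for e f
    proof (cases "e \<in> M \<or> f \<in> M")
      case True
      have "\<not> (e \<in> M \<and> f \<in> M)" using that M(2,3) unfolding inj_on_def by blast
      then show ?thesis using True c(1) that unfolding c'_def by auto
    next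
      case False
      then show ?thesis using c(2) that unfolding c'_def by auto
    qed
    ultimately show ?thesis by blast
  qed simp
qed

section \<open>The theorem of Borodin, Kostochka and Woodall\<close>

abbreviation fibre :: "('e \<Rightarrow> 'a) \<Rightarrow> 'e set \<Rightarrow> 'e \<Rightarrow> 'e set" where
  "fibre p E e \<equiv> {f\<in>E. p f = p e}"

text \<open>The cardinalities of the fibres are the degrees of the two ends of \<open>e\<close>,
  parallel edges counted. The inequality is strict so that lists as large as the larger end degree
  meet the hypothesis of \<open>list_edge_coloring_of_ranking\<close>.\<close>

definition tight_rankings ::
  "('e \<Rightarrow> 'a) \<Rightarrow> ('e \<Rightarrow> 'b) \<Rightarrow> 'e set \<Rightarrow> ('e \<Rightarrow> nat) \<Rightarrow> ('e \<Rightarrow> nat) \<Rightarrow> bool" where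
  "tight_rankings p q E r s \<longleftrightarrow> ranking p r E \<and> ranking q s E \<and>
     (\<forall>e\<in>E. card (better p r E e) + card (better q s E e)
        < max (card (fibre p E e)) (card (fibre q E e)))"

lemma tight_rankings_commute: "tight_rankings p q E r s \<longleftrightarrow> tight_rankings q p E s r"
  unfolding tight_rankings_def by (auto simp: add.commute max.commute)

text \<open>For a set \<open>S\<close> of left vertices let \<open>N(S)\<close> be the set of those neighbours whose degree is at
  least the degree of the end in \<open>S\<close>. A minimal nonempty \<open>S\<close> with \<open>|N(S)| \<le> |S|\<close> either has
  \<open>N(S) = {}\<close> or is matched perfectly onto \<open>N(S)\<close>.\<close>

lemma dominating_matching_exists:
  assumes fin: "finite E" and "E \<noteq> {}" and le: "card (q ` E) \<le> card (p ` E)"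
  shows "\<exists>M\<subseteq>E. M \<noteq> {} \<and> inj_on p M \<and> inj_on q M \<and>
           (\<forall>e\<in>E. p e \<in> p ` M \<longrightarrow> q e \<in> q ` M \<or> card (fibre q E e) < card (fibre p E e))"
proof -
  define N where "N x = q ` {e\<in>E. p e = x \<and> card (fibre p E e) \<le> card (fibre q E e)}" for x
  have finN: "finite (N x)" for x using fin unfolding N_def by simp
  define good where
    "good S \<longleftrightarrow> S \<subseteq> p ` E \<and> S \<noteq> {} \<and> card (\<Union>(N ` S)) \<le> card S" for S
  \<comment> \<open>The full left side is a candidate because there are at most as many right
    vertices; hence a minimal candidate exists.\<close>
  have "\<Union>(N ` p ` E) \<subseteq> q ` E" unfolding N_def by auto
  then have "card (\<Union>(N ` p ` E)) \<le> card (q ` E)" using fin by (intro card_mono) auto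
  then have "good (p ` E)" using le \<open>E \<noteq> {}\<close> unfolding good_def by auto
  then obtain S where S: "good S" and minS: "\<And>T. good T \<Longrightarrow> card S \<le> card T"
    using arg_min_natI[of good _ card] arg_min_nat_le[of good _ card] by metis
  have SE: "S \<subseteq> p ` E" "S \<noteq> {}" and cS: "card (\<Union>(N ` S)) \<le> card S"
    using S unfolding good_def by auto
  have finS: "finite S" using SE(1) fin finite_surj by blast
  have finNS: "finite (\<Union>(N ` S))" using finS finN by auto
  have small: "card T < card (\<Union>(N ` T))" if "T \<subset> S" "T \<noteq> {}" for T
  proof (rule ccontr)
    assume "\<not> ?thesis"
    then have "good T" using that SE unfolding good_def by auto
    then show False using minS[of T] psubset_card_mono[OF finS that(1)] by simp
  qed
  show ?thesis
  proof (cases "\<Union>(N ` S) = {}")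
    case True
    obtain e where e: "e \<in> E" "p e \<in> S" using SE by blast
    have "card (fibre q E f) < card (fibre p E f)" if "f \<in> E" "p f = p e" for f
    proof (rule ccontr)
      assume "\<not> ?thesis"
      then have "q f \<in> N (p e)" using that unfolding N_def by auto
      then show False using True e by blast
    qed
    \<comment> \<open>Every edge at \<open>p e\<close> leads to a vertex of smaller degree, so a
      single edge is already a suitable matching.\<close>
    then show ?thesis using e by (intro exI[of _ "{e}"]) auto
  next
    case False
    \<comment> \<open>Minimality gives Hall's condition only on proper subsets. For \<open>S\<close>
      itself, the strict inequality for \<open>S - {x}\<close> makes up for \<open>x\<close>; a
      singleton \<open>S\<close> uses that \<open>N(S)\<close> is nonempty.\<close>
    have hallS: "card S \<le> card (\<Union>(N ` S))"
    proof -
      obtain x where x: "x \<in> S" using SE by blast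
      show ?thesis
      proof (cases "S - {x} = {}")
        case True
        then have "card S \<le> 1" using card_mono[of "{x}" S] by auto
        moreover have "card (\<Union>(N ` S)) \<noteq> 0" using False finNS by simp
        ultimately show ?thesis by simp
      next
        case False
        then have "card (S - {x}) < card (\<Union>(N ` (S - {x})))" using x by (intro small) auto
        also have "\<dots> \<le> card (\<Union>(N ` S))" using finNS by (intro card_mono) auto
        finally show ?thesis using x finS by simp
      qed
    qed
    have "card T \<le> card (\<Union>(N ` T))" if "T \<subseteq> S" for T
      using small[of T] hallS that by (cases "T = S \<or> T = {}") (auto simp: psubset_eq)
    then obtain m where m: "inj_on m S" "\<forall>x\<in>S. m x \<in> N x"
      using Hall[of S N] finS finN by blast
    have "\<forall>x\<in>S. \<exists>e\<in>E. p e = x \<and> q e = m x" using m(2) unfolding N_def by force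
    then obtain g where g: "\<And>x. x \<in> S \<Longrightarrow> g x \<in> E \<and> p (g x) = x \<and> q (g x) = m x"
      by metis
    have pM: "p ` g ` S = S" using g by force
    have "m ` S = \<Union>(N ` S)"
      using m cS finNS by (intro card_seteq) (auto simp: card_image)
    moreover have "q ` g ` S = m ` S" using g by force
    ultimately have qM: "q ` g ` S = \<Union>(N ` S)" by simp
    have "inj_on p (g ` S)" using g unfolding inj_on_def by auto
    moreover have "inj_on q (g ` S)" using g m(1) unfolding inj_on_def by auto
    moreover have "q e \<in> q ` g ` S \<or> card (fibre q E e) < card (fibre p E e)"
      if e: "e \<in> E" "p e \<in> p ` g ` S" for e
    proof (rule disjCI)
      assume "\<not> card (fibre q E e) < card (fibre p E e)"
      then have "q e \<in> N (p e)" using e unfolding N_def by auto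
      then show "q e \<in> q ` g ` S" using qM pM e by auto
    qed
    ultimately show ?thesis using g SE by (intro exI[of _ "g ` S"]) auto
  qed
qed

lemma card_fibre_Diff_matching:
  assumes "finite E" "M \<subseteq> E" "inj_on p M" "p e \<in> p ` M"
  shows "card (fibre p E e) = Suc (card (fibre p (E - M) e))"
proof -
  obtain f where f: "f \<in> M" "p f = p e" using assms(4) by auto
  then have "fibre p E e = insert f (fibre p (E - M) e)"
    using assms(2,3) unfolding inj_on_def by auto
  then show ?thesis using f assms(1) by simp
qed

text \<open>An edge of \<open>M\<close> has no better edge on the left and fewer than its right
  degree on the right. An edge outside \<open>M\<close> gains at most one better edge, on the left,
  and only if its left end is covered; by \<open>dom\<close> the larger of its end degrees then
  grows by at least one as well.\<close>

lemma tight_rankings_extend: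
  assumes fin: "finite E" and M: "M \<subseteq> E" "inj_on p M" "inj_on q M"
    and dom: "\<And>e. e \<in> E \<Longrightarrow> p e \<in> p ` M \<Longrightarrow>
           q e \<in> q ` M \<or> card (fibre q E e) < card (fibre p E e)"
    and rs: "tight_rankings p q (E - M) r s"
  shows "\<exists>r s. tight_rankings p q E r s"
proof -
  define r' where "r' e = (if e \<in> M then 0 else Suc (r e))" for e
  \<comment> \<open>\<open>Suc (sum s E)\<close> exceeds every value of \<open>s\<close> on
    \<open>E\<close>, which puts \<open>M\<close> last. One common value causes no ties because
    \<open>M\<close> has at most one edge at each vertex.\<close>
  define s' where "s' e = (if e \<in> M then Suc (sum s E) else s e)" for e
  have s_le: "s e < Suc (sum s E)" if "e \<in> E" for e
    using member_le_sum[of e E s] that fin by auto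
  have rank: "ranking p r (E - M)" "ranking q s (E - M)"
    and bound: "\<And>e. e \<in> E - M \<Longrightarrow> card (better p r (E - M) e) + card (better q s (E - M) e)
        < max (card (fibre p (E - M) e)) (card (fibre q (E - M) e))"
    using rs unfolding tight_rankings_def by auto
  have "ranking p r' E"
    using rank(1) M(2) unfolding ranking_def r'_def inj_on_def by auto
  moreover have "ranking q s' E"
    using rank(2) M(3) s_le unfolding ranking_def s'_def inj_on_def
    by (smt (verit, best) Diff_iff less_irrefl)
  moreover have "card (better p r' E e) + card (better q s' E e)
        < max (card (fibre p E e)) (card (fibre q E e))" if e: "e \<in> E" for e
  proof (cases "e \<in> M")
    case True
    then have "better p r' E e = {}" unfolding better_def r'_def by auto
    moreover have "better q s' E e \<subset> fibre q E e" using e unfolding better_def by auto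
    then have "card (better q s' E e) < card (fibre q E e)"
      using fin by (intro psubset_card_mono) auto
    ultimately show ?thesis by simp
  next
    case False
    have q_eq: "better q s' E e = better q s (E - M) e"
      using False s_le[OF e] unfolding better_def s'_def by auto
    have le: "card (fibre p (E - M) e) \<le> card (fibre p E e)"
      "card (fibre q (E - M) e) \<le> card (fibre q E e)"
      using fin by (auto intro: card_mono)
    note bound_e = bound[of e]
    show ?thesis
    proof (cases "p e \<in> p ` M")
      case True
      then obtain f where f: "f \<in> M" "p f = p e" by auto
      then have "better p r' E e = insert f (better p r (E - M) e)"
        using False M(1,2) unfolding better_def r'_def inj_on_def by auto
      moreover have "card (insert f (better p r (E - M) e)) = Suc (card (better p r (E - M) e))"
        using f fin by (subst card_insert_disjoint) (auto simp: better_def)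
      \<comment> \<open>Deleting \<open>M\<close> lowers the left degree by one. The right degree
        either drops too or was already below the left degree, so the maximum drops
        strictly.\<close>
      moreover have "max (card (fibre p (E - M) e)) (card (fibre q (E - M) e))
          < max (card (fibre p E e)) (card (fibre q E e))"
        using card_fibre_Diff_matching[OF fin M(1,2) True] le dom[OF e True]
          card_fibre_Diff_matching[OF fin M(1) M(3), of e] by auto
      moreover have "card (better p r (E - M) e) + card (better q s (E - M) e)
          < max (card (fibre p (E - M) e)) (card (fibre q (E - M) e))"
        using bound_e e False by blast
      ultimately show ?thesis by (simp only: q_eq add_Suc)
    next
      case pe: False
      have "f \<notin> M" if "p f = p e" for f using pe that by (metis imageI)
      then have "better p r' E e = better p r (E - M) e"
        using False unfolding better_def r'_def by auto
      then show ?thesis using q_eq bound_e e False le by auto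
    qed
  qed
  ultimately show ?thesis unfolding tight_rankings_def by blast
qed

lemma tight_rankings_exist:
  assumes "finite E"
  shows "\<exists>r s. tight_rankings p q E r s"
  using assms
proof (induction "card E" arbitrary: E rule: less_induct)
  case less
  show ?case
  proof (cases "E = {}")
    case True
    then show ?thesis unfolding tight_rankings_def ranking_def by simp
  next
    case False
    have IH: "\<exists>r s. tight_rankings p q (E - M) r s" if "M \<subseteq> E" "M \<noteq> {}" for M
    proof (rule less.hyps)
      show "card (E - M) < card E" using that less.prems by (intro psubset_card_mono) auto
    qed (use less.prems in simp)
    show ?thesis
    proof (cases "card (q ` E) \<le> card (p ` E)")
      case True
      then obtain M where M: "M \<subseteq> E" "M \<noteq> {}" "inj_on p M" "inj_on q M"
        "\<And>e. e \<in> E \<Longrightarrow> p e \<in> p ` M \<Longrightarrow>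
           q e \<in> q ` M \<or> card (fibre q E e) < card (fibre p E e)"
        using dominating_matching_exists[OF less.prems False True] by blast
      obtain r s where "tight_rankings p q (E - M) r s" using IH[OF M(1,2)] by blast
      from tight_rankings_extend[OF less.prems M(1,3,4,5) this] show ?thesis .
    next
      case False
      \<comment> \<open>The two sides exchange roles here, and \<open>tight_rankings_commute\<close>
        translates the result back.\<close>
      then have "card (p ` E) \<le> card (q ` E)" by simp
      then obtain M where M: "M \<subseteq> E" "M \<noteq> {}" "inj_on q M" "inj_on p M"
        "\<And>e. e \<in> E \<Longrightarrow> q e \<in> q ` M \<Longrightarrow>
           p e \<in> p ` M \<or> card (fibre p E e) < card (fibre q E e)"
        using dominating_matching_exists[OF less.prems \<open>E \<noteq> {}\<close>, of p q] by blast
      obtain r s where "tight_rankings q p (E - M) s r"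
        using IH[OF M(1,2)] tight_rankings_commute by blast
      from tight_rankings_extend[OF less.prems M(1,3,4,5) this] show ?thesis
        using tight_rankings_commute by blast
    qed
  qed
qed

theorem Borodin_Kostochka_Woodall:
  assumes "finite E" "\<And>e. e \<in> E \<Longrightarrow> finite (L e)"
    and "\<And>e. e \<in> E \<Longrightarrow> card (fibre p E e) \<le> card (L e)"
    and "\<And>e. e \<in> E \<Longrightarrow> card (fibre q E e) \<le> card (L e)"
  shows "\<exists>c. (\<forall>e\<in>E. c e \<in> L e) \<and>
           (\<forall>e\<in>E. \<forall>f\<in>E. e \<noteq> f \<and> (p e = p f \<or> q e = q f) \<longrightarrow> c e \<noteq> c f)"
proof -
  obtain r s where rs: "tight_rankings p q E r s" using tight_rankings_exist[OF assms(1)] by blast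
  show ?thesis
  proof (rule list_edge_coloring_of_ranking)
    fix e assume "e \<in> E"
    then show "card (better p r E e) + card (better q s E e) < card (L e)"
      using rs assms(3,4)[of e] unfolding tight_rankings_def by fastforce
  qed (use assms rs in \<open>auto simp: tight_rankings_def\<close>)
qed

section \<open>Extending total colorings\<close>

lemma simple_graph_finite_edges: "simple_graph V E \<Longrightarrow> finite E"
  unfolding simple_graph_def by (rule finite_subset[of E "Pow V"]) auto

lemma degree_le_max_degree: "finite V \<Longrightarrow> v \<in> V \<Longrightarrow> degree E v \<le> max_degree V E"
  unfolding max_degree_def by (intro Max_ge) auto

lemma card_neighbours_le_degree:
  assumes "finite E"
  shows "card {u. {u, v} \<in> E} \<le> degree E v"
proof -
  have "inj_on (\<lambda>u. {u, v}) {u. {u, v} \<in> E}" by (auto simp: inj_on_def doubleton_eq_iff)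
  moreover have "(\<lambda>u. {u, v}) ` {u. {u, v} \<in> E} \<subseteq> {e\<in>E. v \<in> e}" by auto
  ultimately show ?thesis unfolding degree_def using assms by (intro card_inj_on_le) auto
qed

lemma finite_neighbours:
  assumes "finite E"
  shows "finite {u. {u, v} \<in> E}"
proof (rule finite_imageD)
  show "finite ((\<lambda>u. {u, v}) ` {u. {u, v} \<in> E})"
    using assms by (rule finite_subset[rotated]) auto
qed (auto simp: inj_on_def doubleton_eq_iff)

text \<open>Greedy colouring: a vertex has at most \<open>max_degree V E\<close> neighbours, so one
  of the \<open>k\<close> colours is always free.\<close>

lemma vertex_coloring_extend:
  assumes G: "simple_graph V E" and k: "max_degree V E < k" and "W \<subseteq> V"
    and vc: "\<forall>v\<in>W. vc v \<in> {1..k}" "\<forall>u\<in>W. \<forall>v\<in>W. {u, v} \<in> E \<longrightarrow> vc u \<noteq> vc v"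
  shows "\<exists>vc'. (\<forall>v\<in>V. vc' v \<in> {1..k}) \<and>
           (\<forall>u\<in>V. \<forall>v\<in>V. {u, v} \<in> E \<longrightarrow> vc' u \<noteq> vc' v) \<and> (\<forall>v\<in>W. vc' v = vc v)"
proof -
  have finV: "finite V" using G unfolding simple_graph_def by simp
  have finE: "finite E" using simple_graph_finite_edges[OF G] .
  have "\<exists>vc'. (\<forall>v\<in>W \<union> U. vc' v \<in> {1..k}) \<and>
      (\<forall>u\<in>W \<union> U. \<forall>v\<in>W \<union> U. {u, v} \<in> E \<longrightarrow> vc' u \<noteq> vc' v) \<and> (\<forall>v\<in>W. vc' v = vc v)"
    if "finite U" "U \<subseteq> V - W" for U
    using that
  proof induction
    case empty
    then show ?case using vc by auto
  next
    case (insert x U)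
    then obtain f where f: "\<forall>v\<in>W \<union> U. f v \<in> {1..k}"
      "\<forall>u\<in>W \<union> U. \<forall>v\<in>W \<union> U. {u, v} \<in> E \<longrightarrow> f u \<noteq> f v" "\<forall>v\<in>W. f v = vc v" by auto
    have x: "x \<in> V" "x \<notin> W \<union> U" using insert by auto
    \<comment> \<open>Neighbours not yet coloured are included with whatever value \<open>f\<close>
      has there; avoiding these values too stays within the degree bound.\<close>
    have "card (f ` {u. {u, x} \<in> E}) \<le> card {u. {u, x} \<in> E}"
      using finite_neighbours[OF finE] by (rule card_image_le)
    also have "\<dots> \<le> max_degree V E"
      using card_neighbours_le_degree[OF finE, of x] degree_le_max_degree[OF finV x(1), of E]
      by simp
    finally have "card (f ` {u. {u, x} \<in> E}) < card {1..k}" using k by simp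
    then have "\<not> {1..k} \<subseteq> f ` {u. {u, x} \<in> E}"
      using card_mono[of "f ` {u. {u, x} \<in> E}" "{1..k}"] finite_neighbours[OF finE] by fastforce
    then obtain a where a: "a \<in> {1..k}" "a \<notin> f ` {u. {u, x} \<in> E}" by blast
    have "{x, x} \<notin> E" using G unfolding simple_graph_def by (metis doubleton_eq_iff)
    moreover have "f u \<noteq> a" if "{u, x} \<in> E \<or> {x, u} \<in> E" for u
      using a(2) that by (auto simp: insert_commute)
    ultimately have "\<forall>u\<in>W \<union> insert x U. \<forall>v\<in>W \<union> insert x U. {u, v} \<in> E \<longrightarrow>
        (f(x := a)) u \<noteq> (f(x := a)) v"
      using f(2) by (auto simp: fun_upd_def)
    then show ?case using f x a(1) by (intro exI[of _ "f(x := a)"]) auto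
  qed
  from this[of "V - W"] show ?thesis
    using finV \<open>W \<subseteq> V\<close> by (simp add: Un_absorb1)
qed

theorem theorem4p4:
  fixes V :: "'a set" and E :: "'a set set" and VH :: "'a set" and EH :: "'a set set"
    and \<Delta> d :: nat and vc :: "'a \<Rightarrow> nat" and ec :: "'a set \<Rightarrow> nat"
  assumes "simple_graph V E" and "planar V E" and "bipartite V E"
    and "max_degree V E = \<Delta>"
    and "subgraph VH EH V E" and "max_degree VH EH \<le> d"
    and "total_coloring_in V E VH EH (\<Delta> + d + 4) vc ec"
  shows "\<exists>vc' ec'. total_coloring_in V E V E (\<Delta> + d + 4) vc' ec' \<and>
           (\<forall>v\<in>VH. vc' v = vc v) \<and> (\<forall>e\<in>EH. ec' e = ec e)"
proof -
  define k where "k = \<Delta> + d + 4"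
  have finV: "finite V" using assms(1) unfolding simple_graph_def by simp
  have finE: "finite E" using simple_graph_finite_edges[OF assms(1)] .
  have sub: "VH \<subseteq> V" "EH \<subseteq> E" "\<forall>e\<in>EH. e \<subseteq> VH" using assms(5) unfolding subgraph_def by auto
  have finEH: "finite EH" using finE sub(2) finite_subset by blast
  note H = assms(7)[folded k_def, unfolded total_coloring_in_def]
  obtain vc' where vc': "\<forall>v\<in>V. vc' v \<in> {1..k}"
    "\<forall>u\<in>V. \<forall>v\<in>V. {u, v} \<in> E \<longrightarrow> vc' u \<noteq> vc' v" "\<forall>v\<in>VH. vc' v = vc v"
    using vertex_coloring_extend[OF assms(1) _ sub(1), of k vc] assms(4) H
    unfolding k_def by auto
  obtain A B where AB: "A \<union> B = V" "A \<inter> B = {}"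
    "\<forall>e\<in>E. card (e \<inter> A) = 1 \<and> card (e \<inter> B) = 1"
    using assms(3) unfolding bipartite_def by blast
  \<comment> \<open>The end maps \<open>p\<close> and \<open>q\<close> present the graph in the form
    required by \<open>Borodin_Kostochka_Woodall\<close>.\<close>
  define p where "p e = the_elem (e \<inter> A)" for e
  define q where "q e = the_elem (e \<inter> B)" for e
  have pq: "e \<inter> A = {p e}" "e \<inter> B = {q e}" if "e \<in> E" for e
    using AB(3) that unfolding p_def q_def
    by (metis card_1_singletonE the_elem_eq)+
  have ends: "p e \<in> e" "q e \<in> e" if "e \<in> E" for e using pq[OF that] by auto
  have E_V: "e \<subseteq> V" if "e \<in> E" for e
    using assms(1) that unfolding simple_graph_def by (metis empty_subsetI insert_subset)
  have edge: "e = {p e, q e}" if "e \<in> E" for e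
  proof -
    have "e = (e \<inter> A) \<union> (e \<inter> B)" using E_V[OF that] AB(1) by blast
    then show ?thesis unfolding pq[OF that] by (simp add: insert_commute)
  qed
  have adj: "p e = p f \<or> q e = q f" if ef: "e \<in> E" "f \<in> E" "e \<inter> f \<noteq> {}" for e f
  proof -
    obtain v where v: "v \<in> e" "v \<in> f" using ef(3) by blast
    then have "v \<in> A \<or> v \<in> B" using E_V[OF ef(1)] AB(1) by blast
    then have "v \<in> e \<inter> A \<and> v \<in> f \<inter> A \<or> v \<in> e \<inter> B \<and> v \<in> f \<inter> B" using v by blast
    then show ?thesis unfolding pq[OF ef(1)] pq[OF ef(2)] by auto
  qed
  have degH: "degree EH v \<le> d" for v
  proof (cases "v \<in> VH")
    case True
    then show ?thesis
      using degree_le_max_degree[of VH v EH] finite_subset[OF sub(1) finV] assms(6) by simp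
  next
    case False
    then have "{e\<in>EH. v \<in> e} = {}" using sub(3) by blast
    then show ?thesis unfolding degree_def by (metis card.empty le0)
  qed
  have deg_diff: "card {f\<in>E - EH. v \<in> f} + degree EH v \<le> \<Delta>" if "v \<in> V" for v
  proof -
    have "{f\<in>E. v \<in> f} = {f\<in>E - EH. v \<in> f} \<union> {f\<in>EH. v \<in> f}" using sub(2) by auto
    then have "degree E v = card {f\<in>E - EH. v \<in> f} + degree EH v"
      unfolding degree_def using finE finEH by (subst card_Un_disjoint[symmetric]) auto
    then show ?thesis using degree_le_max_degree[OF finV that, of E] assms(4) by simp
  qed
  \<comment> \<open>The forbidden colours are those of the two ends and of the edges of
    \<open>H\<close> meeting \<open>e\<close>, so only conflicts among the new edges remain.\<close>
  define L where "L e = {1..k} - (vc' ` e \<union> ec ` {f\<in>EH. f \<inter> e \<noteq> {}})" for e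
  have card_L: "\<Delta> + d + 2 \<le> card (L e) + degree EH (p e) + degree EH (q e)" if "e \<in> E" for e
  proof -
    let ?P = "{f\<in>EH. p e \<in> f}" and ?Q = "{f\<in>EH. q e \<in> f}"
    have "f \<inter> e \<noteq> {} \<longleftrightarrow> p e \<in> f \<or> q e \<in> f" for f by (subst edge[OF that]) auto
    then have "{f\<in>EH. f \<inter> e \<noteq> {}} = ?P \<union> ?Q" by blast
    moreover have "card (ec ` (?P \<union> ?Q)) \<le> card (?P \<union> ?Q)"
      using finEH by (intro card_image_le) auto
    ultimately have "card (ec ` {f\<in>EH. f \<inter> e \<noteq> {}}) \<le> card (?P \<union> ?Q)" by (simp only:)
    also have "\<dots> \<le> degree EH (p e) + degree EH (q e)" unfolding degree_def by (rule card_Un_le)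
    finally have 1: "card (ec ` {f\<in>EH. f \<inter> e \<noteq> {}}) \<le> degree EH (p e) + degree EH (q e)" .
    have "vc' ` e = {vc' (p e), vc' (q e)}" using arg_cong[OF edge[OF that], of "image vc'"] by simp
    then have 2: "card (vc' ` e) \<le> 2" by (simp add: card_insert_if)
    have "card {1..k} - card (vc' ` e \<union> ec ` {f\<in>EH. f \<inter> e \<noteq> {}}) \<le> card (L e)"
      unfolding L_def using finEH
      by (intro diff_card_le_card_Diff finite_UnI finite_imageI)
        (auto intro: finite_subset[OF E_V[OF that] finV])
    then show ?thesis
      using 1 2 card_Un_le[of "vc' ` e" "ec ` {f\<in>EH. f \<inter> e \<noteq> {}}"] unfolding k_def by simp
  qed
  have "\<exists>c. (\<forall>e\<in>E - EH. c e \<in> L e) \<and>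
      (\<forall>e\<in>E - EH. \<forall>f\<in>E - EH. e \<noteq> f \<and> (p e = p f \<or> q e = q f) \<longrightarrow> c e \<noteq> c f)"
  proof (rule Borodin_Kostochka_Woodall)
    fix e assume e: "e \<in> E - EH"
    then have V: "p e \<in> V" "q e \<in> V" using ends[of e] E_V[of e] by auto
    have "fibre p (E - EH) e \<subseteq> {f\<in>E - EH. p e \<in> f}" by (auto dest: ends)
    then have "card (fibre p (E - EH) e) \<le> card {f\<in>E - EH. p e \<in> f}"
      using finE by (intro card_mono) auto
    then show "card (fibre p (E - EH) e) \<le> card (L e)"
      \<comment> \<open>At \<open>p e\<close> at most \<open>\<Delta> - degree EH (p e)\<close>
        edges remain. The summand \<open>d\<close> in \<open>k\<close> absorbs the colours lost
        through edges of \<open>H\<close> at the other end \<open>q e\<close>.\<close>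
      using deg_diff[OF V(1)] card_L[of e] degH[of "q e"] e by auto
    have "fibre q (E - EH) e \<subseteq> {f\<in>E - EH. q e \<in> f}" by (auto dest: ends)
    then have "card (fibre q (E - EH) e) \<le> card {f\<in>E - EH. q e \<in> f}"
      using finE by (intro card_mono) auto
    then show "card (fibre q (E - EH) e) \<le> card (L e)"
      using deg_diff[OF V(2)] card_L[of e] degH[of "p e"] e by auto
  qed (use finE in \<open>auto simp: L_def\<close>)
  then obtain c where c: "\<And>e. e \<in> E - EH \<Longrightarrow> c e \<in> L e"
    "\<And>e f. e \<in> E - EH \<Longrightarrow> f \<in> E - EH \<Longrightarrow> e \<noteq> f \<Longrightarrow> p e = p f \<or> q e = q f \<Longrightarrow> c e \<noteq> c f"
    by metis
  define ec' where "ec' e = (if e \<in> EH then ec e else c e)" for e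
  have "ec' e \<in> {1..k}" if "e \<in> E" for e
    using c(1)[of e] that H unfolding ec'_def L_def by auto
  moreover have "ec' e \<noteq> ec' f" if "e \<in> E" "f \<in> E" "e \<noteq> f" "e \<inter> f \<noteq> {}" for e f
  proof -
    \<comment> \<open>A new edge and an edge of \<open>H\<close> are separated by the choice of
      \<open>L\<close>, two edges of \<open>H\<close> by the given colouring, and two new edges by
      the list colouring.\<close>
    have mixed: "c g \<noteq> ec h" if "g \<in> E - EH" "h \<in> EH" "h \<inter> g \<noteq> {}" for g h
      using c(1)[OF that(1)] that unfolding L_def by auto
    show ?thesis
    proof (cases "e \<in> EH \<longleftrightarrow> f \<in> EH")
      case True
      then show ?thesis using H c(2)[of e f] adj[of e f] that unfolding ec'_def by auto
    next
      case False
      then show ?thesis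
        using mixed[of e f] mixed[of f e] that unfolding ec'_def by (auto simp: Int_commute)
    qed
  qed
  moreover have "ec' e \<noteq> vc' v" if "e \<in> E" "v \<in> e" for e v
  proof (cases "e \<in> EH")
    case True
    then have "v \<in> VH" using sub(3) that by blast
    then show ?thesis using H True vc'(3) that unfolding ec'_def by simp
  next
    case False
    then show ?thesis using c(1)[of e] that unfolding ec'_def L_def by auto
  qed
  ultimately have "total_coloring_in V E V E k vc' ec'"
    using vc' unfolding total_coloring_in_def by blast
  moreover have "\<forall>e\<in>EH. ec' e = ec e" unfolding ec'_def by simp
  ultimately show ?thesis using vc'(3) unfolding k_def by blast
qed

end
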